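(* Let $n$ be a positive integer and let $\mathcal{D}=(\mathsf{D}_1,\dots,\mathsf{D}_m)$ be a family of $m=\left\lfloor \frac{6(n-1)}{5}\right\rfloor+1$ (not necessarily distinct as uncolored graphs) even cycles on a fixed vertex set of size $n$. Then $\mathcal{D}$ contains a rainbow even cycle.
   Context: A (colored) graph is a finite set $\mathsf G$ of pairs $(e,\alpha)$, where the $e$'s are pairwise distinct 2-element subsets $\{u,v\}$ (written $uv$) of a vertex set and $\alpha$ is a color (different edges may have the same color). $V(\mathsf G)$ is the set of vertices of its edges, $E(\mathsf G)$ the set of its underlying uncolored edges, $\chi(\mathsf G)$ the set of colors used. $\mathsf G$ is rainbow if $|\chi(\mathsf G)|=|\mathsf G|$. A cycle is a colored graph whose underlying uncolored edge set forms a cycle (length $\ge 3$); its length is its number of edges; it is even if its length is even. A family of cycles on a vertex set $V$ is a list $\mathcal D=(\mathsf D_1,\dots,\mathsf D_m)$ of cycles with $V(\mathsf D_i)\subseteq V$, where all edges of $\mathsf D_i$ receive one color $\alpha_i$ and $\alpha_1,\dots,\alpha_m$ are pairwise distinct (the underlying uncolored cycles may coincide). A subgraph of $\mathcal D$ is a (simple) colored graph $\mathsf G\subseteq \bigcup_i \mathsf D_i$, and $\mathcal D$ contains $\mathsf G$ if $\mathsf G$ is a subgraph of $\mathcal D$. Thus a rainbow even cycle in $\mathcal D$ is an even cycle formed by edges taken from pairwise distinct $\mathsf D_i$'s. *)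

theory Defs
  imports Main
begin

definition is_cycle :: "'a set set \<Rightarrow> bool" where
  "is_cycle C \<longleftrightarrow> (\<exists>vs. length vs \<ge> 3 \<and> distinct vs \<and>
      C = {{vs ! i, vs ! ((i + 1) mod length vs)} | i. i < length vs})"

definition even_cycle :: "'a set set \<Rightarrow> bool" where
  "even_cycle C \<longleftrightarrow> is_cycle C \<and> even (card C)"

text \<open>A family of cycles is a list D; cycle D!i carries colour i (so colours are
  pairwise distinct). A rainbow subgraph whose edges form the cycle C is given by a
  choice of colour f e for each edge e of C with e in D!(f e), f injective.\<close>
definition has_rainbow_even_cycle :: "'a set set list \<Rightarrow> bool" where
  "has_rainbow_even_cycle D \<longleftrightarrow> (\<exists>C f. even_cycle C \<and> inj_on f C \<and>
      (\<forall>e\<in>C. f e < length D \<and> e \<in> D ! f e))"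

end

theory Submission
  imports Defs
begin

text \<open>Suppose that there is no rainbow even cycle, and take a rainbow forest with as many edges as
  possible. If a colour \<open>k\<close> is missing from it, then every edge of \<open>D ! k\<close> outside the forest closes
  an odd cycle with the forest, and may be swapped for any other edge of that cycle. Swaps starting
  at different missing colours never interfere, so the colours that can be freed from \<open>k\<close> and from
  another missing colour \<open>l\<close> form disjoint classes. The cycles of a class of size \<open>c\<close> all live on at
  most \<open>c\<close> vertices, and for \<open>c \<le> 5\<close> this forces a rainbow 4-cycle. Hence every class contains at
  least five colours of the forest besides its missing colour, and the number of colours is at most
  \<open>6/5\<close> of the number of forest edges.\<close>

section \<open>Cycles and cuts\<close>

text \<open>Exchanging edges is awkward to track with paths and trees, whereas cuts add modulo 2.
  Independence, exchangeability and bipartition therefore all become parity statements about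
  \<open>crosses\<close>: a swap is legitimate because the new edge crosses a cut that only the old
  edge crossed, and an edge closes an odd cycle because it does not cross the cut crossed by all
  forest edges. A class is collected over many successive forests, so its disjointness from another
  class cannot be read off one forest; it comes from commuting whole sequences of swaps. The
  constant five is where the local argument stops. On at most five vertices every even cycle is a
  four-cycle, and w four-cycles with two private edges each, plus one common edge, need 2w + 1 of
  the w(w - 1)/2 pairs, which is impossible for w = 4 and w = 5 but not for w = 6.\<close>

definition crosses :: "'a set \<Rightarrow> 'a set \<Rightarrow> bool" where
  "crosses e X \<longleftrightarrow> e \<inter> X \<noteq> {} \<and> \<not> e \<subseteq> X"

lemma crosses_pair [simp]: "crosses {u, v} X \<longleftrightarrow> (u \<in> X) \<noteq> (v \<in> X)"
  by (auto simp: crosses_def)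

text \<open>Addition of cuts modulo 2; it repairs the separating cuts whenever an edge enters the
  forest.\<close>

lemma crosses_sym_diff:
  assumes "card e = 2"
  shows "crosses e ((X - Y) \<union> (Y - X)) \<longleftrightarrow> crosses e X \<noteq> crosses e Y"
proof -
  obtain u v where "e = {u, v}" using assms by (auto simp: card_2_iff)
  then show ?thesis by auto
qed

lemma even_card_changes:
  fixes f :: "nat \<Rightarrow> bool"
  shows "even (card {i. i < n \<and> f i \<noteq> f (Suc i)}) \<longleftrightarrow> f 0 = f n"
proof (induction n)
  case (Suc n)
  have "{i. i < Suc n \<and> f i \<noteq> f (Suc i)} =
      (if f n \<noteq> f (Suc n) then insert n {i. i < n \<and> f i \<noteq> f (Suc i)}
       else {i. i < n \<and> f i \<noteq> f (Suc i)})"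
    by (auto simp: less_Suc_eq)
  then show ?case using Suc by auto
qed auto

definition cyc_edge :: "'a list \<Rightarrow> nat \<Rightarrow> 'a set" where
  "cyc_edge vs i = {vs ! i, vs ! (Suc i mod length vs)}"

lemma is_cycle_iff:
  "is_cycle C \<longleftrightarrow> (\<exists>vs. length vs \<ge> 3 \<and> distinct vs \<and> C = cyc_edge vs ` {..<length vs})"
proof -
  have "{{vs ! i, vs ! ((i + 1) mod length vs)} | i. i < length vs} = cyc_edge vs ` {..<length vs}"
    for vs :: "'a list" by (auto simp: cyc_edge_def)
  then show ?thesis unfolding is_cycle_def by simp
qed

lemma Suc_mod_less: "i < n \<Longrightarrow> Suc i mod n = (if Suc i = n then 0 else Suc i)"
  by auto

lemma inj_on_cyc_edge:
  assumes "length vs \<ge> 3" "distinct vs"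
  shows "inj_on (cyc_edge vs) {..<length vs}"
proof (rule inj_onI)
  fix i j assume ij: "i \<in> {..<length vs}" "j \<in> {..<length vs}" "cyc_edge vs i = cyc_edge vs j"
  let ?i = "Suc i mod length vs" and ?j = "Suc j mod length vs"
  have less: "i < length vs" "j < length vs" "?i < length vs" "?j < length vs"
    using ij by (auto intro: mod_less_divisor)
  then have "i = j \<and> ?i = ?j \<or> i = ?j \<and> j = ?i"
    using ij(3) assms(2) by (auto simp: cyc_edge_def doubleton_eq_iff nth_eq_iff_index_eq)
  then show "i = j"
    using less(1,2) assms(1) by (auto simp: Suc_mod_less split: if_splits)
qed

lemma is_cycle_nonempty: "is_cycle C \<Longrightarrow> C \<noteq> {}"
  by (auto simp: is_cycle_iff lessThan_empty_iff)

lemma is_cycle_edge_card: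
  assumes "is_cycle C" "e \<in> C" shows "card e = 2"
proof -
  obtain vs i where vs: "length vs \<ge> 3" "distinct vs" "e = cyc_edge vs i" "i < length vs"
    using assms by (auto simp: is_cycle_iff)
  then have "Suc i mod length vs < length vs" "Suc i mod length vs \<noteq> i"
    by (auto simp: Suc_mod_less)
  then have "vs ! i \<noteq> vs ! (Suc i mod length vs)"
    using vs by (simp add: nth_eq_iff_index_eq)
  then show ?thesis using vs by (simp add: cyc_edge_def)
qed

text \<open>Walking once round the cycle ends on the side of \<open>X\<close> where it began.
  Reading the index of \<open>f\<close> modulo the length makes the closing edge an ordinary
  change.\<close>

lemma even_card_cycle_cut:
  assumes "is_cycle C"
  shows "even (card {e \<in> C. crosses e X})"
proof -
  obtain vs where vs: "length vs \<ge> 3" "distinct vs" "C = cyc_edge vs ` {..<length vs}"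
    using assms by (auto simp: is_cycle_iff)
  define f where "f i \<longleftrightarrow> vs ! (i mod length vs) \<in> X" for i
  have eq: "{e \<in> C. crosses e X} = cyc_edge vs ` {i. i < length vs \<and> f i \<noteq> f (Suc i)}"
    using vs(3) by (auto simp: f_def cyc_edge_def)
  have "inj_on (cyc_edge vs) {i. i < length vs \<and> f i \<noteq> f (Suc i)}"
    by (rule inj_on_subset[OF inj_on_cyc_edge[OF vs(1,2)]]) auto
  then have "card {e \<in> C. crosses e X} = card {i. i < length vs \<and> f i \<noteq> f (Suc i)}"
    unfolding eq by (rule card_image)
  moreover have "f 0 = f (length vs)" by (simp add: f_def)
  ultimately show ?thesis by (simp only: even_card_changes)
qed

lemma cycle_cut_other_edge:
  assumes "is_cycle C" "e \<in> C" "crosses e X"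
  obtains e' where "e' \<in> C" "e' \<noteq> e" "crosses e' X"
proof -
  have "{e' \<in> C. crosses e' X} \<noteq> {e}"
    using even_card_cycle_cut[OF assms(1), of X] by auto
  then show thesis using assms that by blast
qed

text \<open>Connectedness of a cycle, phrased in terms of cuts.\<close>

lemma is_cycle_subset_if_uncut:
  assumes C: "is_cycle C" and uncut: "\<And>e. e \<in> C \<Longrightarrow> \<not> crosses e X" and meets: "\<Union>C \<inter> X \<noteq> {}"
  shows "\<Union>C \<subseteq> X"
proof -
  obtain vs where vs: "length vs \<ge> 3" "distinct vs" "C = cyc_edge vs ` {..<length vs}"
    using C by (auto simp: is_cycle_iff)
  have step: "vs ! i \<in> X \<longleftrightarrow> vs ! Suc i \<in> X" if "Suc i < length vs" for i
  proof -
    have "cyc_edge vs i \<in> C" using that vs(3) by simp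
    then show ?thesis using uncut[of "cyc_edge vs i"] that by (auto simp: cyc_edge_def)
  qed
  have all: "vs ! i \<in> X \<longleftrightarrow> vs ! 0 \<in> X" if "i < length vs" for i
    using that by (induction i) (auto simp: step)
  have "\<exists>i < length vs. x = vs ! i" if x: "x \<in> \<Union>C" for x
  proof -
    obtain i where i: "i < length vs" "x \<in> cyc_edge vs i" using x vs(3) by auto
    then have "Suc i mod length vs < length vs" by (auto intro: mod_less_divisor)
    then show ?thesis using i by (auto simp: cyc_edge_def)
  qed
  then show ?thesis using meets all by blast
qed

lemma cycle_two_edge_cut:
  assumes "is_cycle C" "e \<in> C" "e' \<in> C" "e \<noteq> e'"
  shows "\<exists>X. \<forall>d \<in> C. crosses d X \<longleftrightarrow> d = e \<or> d = e'"
proof -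
  obtain vs where vs: "length vs \<ge> 3" "distinct vs" "C = cyc_edge vs ` {..<length vs}"
    using assms by (auto simp: is_cycle_iff)
  have *: "\<exists>X. \<forall>d \<in> C. crosses d X \<longleftrightarrow> d = cyc_edge vs i \<or> d = cyc_edge vs j"
    if ij: "i < j" "j < length vs" for i j
  proof -
    \<comment> \<open>The arc from position \<open>i + 1\<close> to position \<open>j\<close> is
      left only through the edges at positions \<open>i\<close> and \<open>j\<close>.\<close>
    let ?X = "(\<lambda>t. vs ! t) ` {i<..j}"
    have mem: "vs ! t \<in> ?X \<longleftrightarrow> i < t \<and> t \<le> j" if "t < length vs" for t
      using that ij vs(2) by (auto simp: nth_eq_iff_index_eq)
    have "crosses (cyc_edge vs t) ?X \<longleftrightarrow> t = i \<or> t = j" if "t < length vs" for t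
    proof -
      have "Suc t mod length vs < length vs" using that by (auto intro: mod_less_divisor)
      then have "crosses (cyc_edge vs t) ?X \<longleftrightarrow>
          (i < t \<and> t \<le> j) \<noteq> (i < Suc t mod length vs \<and> Suc t mod length vs \<le> j)"
        using that by (simp only: cyc_edge_def crosses_pair mem)
      also have "\<dots> \<longleftrightarrow> t = i \<or> t = j"
        using ij that by (auto simp: Suc_mod_less)
      finally show ?thesis .
    qed
    moreover have "cyc_edge vs t = cyc_edge vs s \<longleftrightarrow> t = s" if "t < length vs" "s < length vs" for t s
      using inj_on_cyc_edge[OF vs(1,2)] that by (auto simp: inj_on_def)
    ultimately show ?thesis
      using vs(3) ij by (intro exI[of _ ?X]) (auto simp del: crosses_pair)
  qed
  obtain i j where ij: "e = cyc_edge vs i" "i < length vs" "e' = cyc_edge vs j" "j < length vs"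
    using assms vs(3) by auto
  have "i < j \<or> j < i" using ij assms(4) by (cases "i = j") auto
  then show ?thesis using *[of i j] *[of j i] ij by (elim disjE) blast+
qed

text \<open>A cut through one edge of \<open>C\<close> and one edge missing from \<open>C\<close>
  would meet \<open>C\<close> exactly once.\<close>

lemma is_cycle_subset_eq:
  assumes C: "is_cycle C" and D: "is_cycle D" and "C \<subseteq> D"
  shows "C = D"
proof (rule ccontr)
  assume "C \<noteq> D"
  then obtain e where e: "e \<in> D" "e \<notin> C" using \<open>C \<subseteq> D\<close> by blast
  obtain e' where e': "e' \<in> C" using is_cycle_nonempty[OF C] by blast
  have "e' \<in> D" "e \<noteq> e'" using e e' \<open>C \<subseteq> D\<close> by auto
  from cycle_two_edge_cut[OF D e(1) this]
  obtain X where X: "\<forall>d \<in> D. crosses d X \<longleftrightarrow> d = e \<or> d = e'" ..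
  have "{d \<in> C. crosses d X} = {e'}" using X e e' \<open>C \<subseteq> D\<close> by auto
  then show False using even_card_cycle_cut[OF C, of X] by simp
qed

section \<open>Paths and connected components\<close>

definition adj :: "'a set set \<Rightarrow> ('a \<times> 'a) set" where
  "adj E = {(x, y). {x, y} \<in> E}"

lemma simple_path_if_connected:
  assumes "(u, v) \<in> (adj E)\<^sup>*"
  shows "\<exists>xs. distinct xs \<and> xs \<noteq> [] \<and> hd xs = u \<and> last xs = v \<and>
    (\<forall>i. Suc i < length xs \<longrightarrow> {xs ! i, xs ! Suc i} \<in> E)"
  using assms
proof (induction rule: rtrancl_induct)
  case base
  show ?case by (intro exI[of _ "[u]"]) auto
next
  case (step y z)
  then obtain xs where xs: "distinct xs" "xs \<noteq> []" "hd xs = u" "last xs = y"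
    "\<And>i. Suc i < length xs \<Longrightarrow> {xs ! i, xs ! Suc i} \<in> E" by blast
  show ?case
  proof (cases "z \<in> set xs")
    case True
    then obtain i where i: "i < length xs" "xs ! i = z" by (auto simp: in_set_conv_nth)
    have "last (take (Suc i) xs) = z" using i by (simp add: take_Suc_conv_app_nth)
    moreover have "hd (take (Suc i) xs) = u" using xs by simp
    ultimately show ?thesis using xs i by (intro exI[of _ "take (Suc i) xs"]) auto
  next
    case False
    have yz: "{y, z} \<in> E" using step by (auto simp: adj_def)
    have "{(xs @ [z]) ! i, (xs @ [z]) ! Suc i} \<in> E" if "Suc i < length (xs @ [z])" for i
    proof (cases "Suc i < length xs")
      case True
      then show ?thesis using xs(5)[of i] by (simp add: nth_append)
    next
      case False
      then have "i = length xs - 1" "Suc i = length xs" using that by auto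
      then show ?thesis using yz xs(2,4) by (simp add: nth_append last_conv_nth)
    qed
    then show ?thesis using xs False by (intro exI[of _ "xs @ [z]"]) auto
  qed
qed

lemma cycle_if_connected:
  assumes conn: "(u, v) \<in> (adj E)\<^sup>*" and "u \<noteq> v" "{u, v} \<notin> E"
  obtains Q where "Q \<subseteq> E" "is_cycle (insert {u, v} Q)"
proof -
  obtain xs where xs: "distinct xs" "xs \<noteq> []" "hd xs = u" "last xs = v"
    "\<And>i. Suc i < length xs \<Longrightarrow> {xs ! i, xs ! Suc i} \<in> E"
    using simple_path_if_connected[OF conn] by blast
  have u: "xs ! 0 = u" and v: "xs ! (length xs - 1) = v"
    using xs by (auto simp: hd_conv_nth last_conv_nth)
  have "length xs \<noteq> 1" using u v assms(2) by auto
  \<comment> \<open>A path on two vertices would be the edge \<open>{u, v}\<close> itself, which is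
    not in \<open>E\<close>.\<close>
  moreover have "length xs \<noteq> 2" using u v xs(5)[of 0] assms(3) by auto
  ultimately have len: "length xs \<ge> 3" using xs(2) by (cases xs) (auto simp: neq_Nil_conv)
  define Q where "Q = cyc_edge xs ` {..<length xs - 1}"
  have "{..<length xs} = insert (length xs - 1) {..<length xs - 1}" using len by auto
  moreover have "Suc (length xs - 1) = length xs" using len by simp
  then have "cyc_edge xs (length xs - 1) = {u, v}"
    using u v by (simp add: cyc_edge_def insert_commute)
  ultimately have "insert {u, v} Q = cyc_edge xs ` {..<length xs}" by (metis Q_def image_insert)
  then have "is_cycle (insert {u, v} Q)" using len xs(1) by (auto simp: is_cycle_iff)
  moreover have "Q \<subseteq> E"
  proof
    fix e assume "e \<in> Q"
    then obtain i where "i < length xs - 1" "e = cyc_edge xs i" by (auto simp: Q_def)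
    then show "e \<in> E" using xs(5)[of i] by (auto simp: cyc_edge_def)
  qed
  ultimately show thesis using that by blast
qed

lemma uncut_component:
  assumes "card f = 2" "f \<in> E"
  shows "\<not> crosses f {x. (v, x) \<in> (adj E)\<^sup>*}"
proof -
  obtain x y where xy: "f = {x, y}" using assms(1) by (auto simp: card_2_iff)
  then have "(x, y) \<in> adj E" "(y, x) \<in> adj E"
    using assms(2) by (auto simp: adj_def insert_commute)
  then show ?thesis unfolding xy by (auto intro: rtrancl_into_rtrancl)
qed

lemma finite_component:
  assumes "finite V" "\<Union>E \<subseteq> V"
  shows "finite {x. (v, x) \<in> (adj E)\<^sup>*}"
proof (rule finite_subset)
  show "{x. (v, x) \<in> (adj E)\<^sup>*} \<subseteq> insert v V"
  proof
    fix x assume "x \<in> {x. (v, x) \<in> (adj E)\<^sup>*}"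
    then have "(v, x) \<in> (adj E)\<^sup>*" by simp
    then show "x \<in> insert v V"
      by (cases rule: rtranclE) (use assms(2) in \<open>auto simp: adj_def\<close>)
  qed
qed (use assms(1) in simp)

text \<open>A set around \<open>v\<close> is grown one vertex at a time along an edge that leaves
  it. Each such edge is new, so \<open>t + 1\<close> vertices span at least \<open>t\<close>
  edges.\<close>

lemma card_component_le:
  assumes "finite E" "finite V" "\<Union>E \<subseteq> V"
  shows "card {x. (v, x) \<in> (adj E)\<^sup>*} \<le> card E + 1"
proof -
  let ?W = "{x. (v, x) \<in> (adj E)\<^sup>*}"
  have fin: "finite ?W" using finite_component[OF assms(2,3)] .
  have "\<exists>X \<subseteq> ?W. v \<in> X \<and> card X = Suc t \<and> t \<le> card {e \<in> E. e \<subseteq> X}" if "Suc t \<le> card ?W" for t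
    using that
  proof (induction t)
    case 0
    show ?case by (intro exI[of _ "{v}"]) auto
  next
    case (Suc t)
    then obtain X where X: "X \<subseteq> ?W" "v \<in> X" "card X = Suc t" "t \<le> card {e \<in> E. e \<subseteq> X}" by auto
    have "\<exists>x y. x \<in> X \<and> y \<notin> X \<and> {x, y} \<in> E"
    proof (rule ccontr)
      assume no: "\<not> ?thesis"
      have "x \<in> X" if "(v, x) \<in> (adj E)\<^sup>*" for x
        using that by (induction rule: rtrancl_induct) (use X(2) no in \<open>auto simp: adj_def\<close>)
      then have "?W = X" using X(1) by auto
      then show False using X(3) Suc.prems by simp
    qed
    then obtain x y where xy: "x \<in> X" "y \<notin> X" "{x, y} \<in> E" by blast
    have y: "y \<in> ?W" using xy X(1) by (auto simp: adj_def intro: rtrancl_into_rtrancl)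
    have "insert {x, y} {e \<in> E. e \<subseteq> X} \<subseteq> {e \<in> E. e \<subseteq> insert y X}" using xy by auto
    moreover have "{x, y} \<notin> {e \<in> E. e \<subseteq> X}" using xy by auto
    ultimately have "Suc (card {e \<in> E. e \<subseteq> X}) \<le> card {e \<in> E. e \<subseteq> insert y X}"
      using assms(1) card_mono[of "{e \<in> E. e \<subseteq> insert y X}" "insert {x, y} {e \<in> E. e \<subseteq> X}"] by simp
    moreover have "finite X" using X(1) fin finite_subset by blast
    ultimately show ?case using X xy y by (intro exI[of _ "insert y X"]) auto
  qed
  from this[of "card ?W - 1"] fin obtain X where
    "card ?W - 1 \<le> card {e \<in> E. e \<subseteq> X}"
    by (metis (no_types, lifting) Suc_pred' card_gt_0_iff empty_iff mem_Collect_eq order_refl rtrancl.rtrancl_refl)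
  also have "\<dots> \<le> card E" using assms(1) by (intro card_mono) auto
  finally show ?thesis by simp
qed

section \<open>Few vertices\<close>

text \<open>Serves to give the edges of a single four-cycle distinct colours; where this fails, some
  edges together see too few colours. The proof is the Halmos-Vaughan induction.\<close>

lemma hall_marriage:
  assumes "finite I" "\<And>i. i \<in> I \<Longrightarrow> finite (A i)"
    and "\<And>J. J \<subseteq> I \<Longrightarrow> card J \<le> card (\<Union>(A ` J))"
  shows "\<exists>f. inj_on f I \<and> (\<forall>i \<in> I. f i \<in> A i)"
  using assms
proof (induction I arbitrary: A rule: finite_psubset_induct)
  case (psubset I)
  show ?case
  proof (cases "\<exists>J. J \<noteq> {} \<and> J \<subset> I \<and> card (\<Union>(A ` J)) \<le> card J")
    case True
    \<comment> \<open>A tight proper subfamily is matched first. Removing all that it covers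
      preserves Hall's condition for the rest, precisely because it is tight.\<close>
    then obtain J where J: "J \<noteq> {}" "J \<subset> I" "card (\<Union>(A ` J)) \<le> card J" by blast
    have "\<exists>f. inj_on f J \<and> (\<forall>i \<in> J. f i \<in> A i)"
      using psubset.prems J(2) by (intro psubset.IH) auto
    then obtain f where f: "inj_on f J" "\<forall>i \<in> J. f i \<in> A i" by blast
    define B where "B i = A i - \<Union>(A ` J)" for i
    have "\<exists>g. inj_on g (I - J) \<and> (\<forall>i \<in> I - J. g i \<in> B i)"
    proof (intro psubset.IH)
      show "I - J \<subset> I" using J by blast
      show "finite (B i)" if "i \<in> I - J" for i using that psubset.prems(1) by (auto simp: B_def)
      fix L assume L: "L \<subseteq> I - J"
      have fin: "finite L" "finite J" using L J(2) psubset.hyps finite_subset by blast+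
      have "card L + card J = card (L \<union> J)"
        using fin L by (subst card_Un_disjoint) auto
      also have "\<dots> \<le> card (\<Union>(A ` (L \<union> J)))" using L J(2) by (intro psubset.prems(2)) auto
      also have "\<Union>(A ` (L \<union> J)) = \<Union>(B ` L) \<union> \<Union>(A ` J)" by (auto simp: B_def)
      also have "card \<dots> \<le> card (\<Union>(B ` L)) + card (\<Union>(A ` J))" by (rule card_Un_le)
      finally show "card L \<le> card (\<Union>(B ` L))" using J(3) by linarith
    qed
    then obtain g where g: "inj_on g (I - J)" "\<forall>i \<in> I - J. g i \<in> B i" by blast
    let ?h = "\<lambda>i. if i \<in> J then f i else g i"
    have "inj_on ?h I"
    proof (rule inj_onI)
      fix x y assume xy: "x \<in> I" "y \<in> I" "?h x = ?h y"
      have "f a \<noteq> g b" if "a \<in> J" "b \<in> I - J" for a b using that f(2) g(2) by (auto simp: B_def)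
      then show "x = y" using xy f(1) g(1) by (auto simp: inj_on_def split: if_splits) metis+
    qed
    moreover have "\<forall>i \<in> I. ?h i \<in> A i" using f(2) g(2) by (auto simp: B_def)
    ultimately show ?thesis by (intro exI[of _ ?h]) blast
  next
    case False
    show ?thesis
    proof (cases "I = {}")
      case True
      then show ?thesis by auto
    next
      case nonempty: False
      \<comment> \<open>With no tight proper subfamily, each nonempty one has an element to spare,
        so one arbitrary choice is affordable.\<close>
      then obtain i where i: "i \<in> I" by blast
      have "A i \<noteq> {}" using psubset.prems(2)[of "{i}"] i by auto
      then obtain x where x: "x \<in> A i" by blast
      have "\<exists>g. inj_on g (I - {i}) \<and> (\<forall>j \<in> I - {i}. g j \<in> A j - {x})"
      proof (intro psubset.IH)
        show "I - {i} \<subset> I" using i by blast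
        show "finite (A j - {x})" if "j \<in> I - {i}" for j using that psubset.prems(1) by auto
        fix L assume L: "L \<subseteq> I - {i}"
        show "card L \<le> card (\<Union>j \<in> L. A j - {x})"
        proof (cases "L = {}")
          case False
          have "L \<subset> I" using L i by blast
          then have "card L < card (\<Union>(A ` L))"
            using \<open>\<not> (\<exists>J. J \<noteq> {} \<and> J \<subset> I \<and> card (\<Union>(A ` J)) \<le> card J)\<close> False not_less by blast
          moreover have "(\<Union>j \<in> L. A j - {x}) = \<Union>(A ` L) - {x}" by auto
          moreover have "card (\<Union>(A ` L)) - 1 \<le> card (\<Union>(A ` L) - {x})"
            by (simp add: card_Diff_singleton_if)
          ultimately show ?thesis by simp
        qed simp
      qed
      then obtain g where g: "inj_on g (I - {i})" "\<forall>j \<in> I - {i}. g j \<in> A j - {x}" by blast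
      have "inj_on (g(i := x)) I" using g by (auto simp: inj_on_def)
      moreover have "\<forall>j \<in> I. (g(i := x)) j \<in> A j" using g x by auto
      ultimately show ?thesis by blast
    qed
  qed
qed

section \<open>Four-cycles on at most five vertices\<close>

definition square :: "'a \<Rightarrow> 'a \<Rightarrow> 'a \<Rightarrow> 'a \<Rightarrow> 'a set set" where
  "square a b c d = {{a, b}, {b, c}, {c, d}, {d, a}}"

lemma square_rotate: "square a b c d = square b c d a"
  by (simp add: square_def insert_commute)

lemma card_square: "distinct [a, b, c, d] \<Longrightarrow> card (square a b c d) = 4"
  by (auto simp: square_def doubleton_eq_iff card_insert_if)

lemma cyc_edge_image_square: "cyc_edge [a, b, c, d] ` {..<length [a, b, c, d]} = square a b c d"
proof -
  have "{..<length [a, b, c, d]} = {0, 1, 2, 3}" by auto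
  then have "cyc_edge [a, b, c, d] ` {..<length [a, b, c, d]} =
      {cyc_edge [a, b, c, d] 0, cyc_edge [a, b, c, d] 1, cyc_edge [a, b, c, d] 2, cyc_edge [a, b, c, d] 3}"
    by (simp only: image_insert image_empty)
  then show ?thesis by (simp add: square_def cyc_edge_def)
qed

lemma even_cycle_square:
  assumes "distinct [a, b, c, d]" shows "even_cycle (square a b c d)"
proof -
  have "is_cycle (square a b c d)"
    unfolding is_cycle_iff
  proof (intro exI conjI)
    show "square a b c d = cyc_edge [a, b, c, d] ` {..<length [a, b, c, d]}"
      by (rule cyc_edge_image_square[symmetric])
  qed (use assms in simp_all)
  then show ?thesis using card_square[OF assms] by (simp add: even_cycle_def)
qed

lemma square_if_even_cycle:
  assumes "even_cycle C" "\<Union>C \<subseteq> W" "finite W" "card W \<le> 5"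
  obtains a b c d where "distinct [a, b, c, d]" "{a, b, c, d} \<subseteq> W" "C = square a b c d"
proof -
  obtain vs where vs: "length vs \<ge> 3" "distinct vs" "C = cyc_edge vs ` {..<length vs}"
    using assms(1) by (auto simp: even_cycle_def is_cycle_iff)
  have "card C = length vs" using vs card_image[OF inj_on_cyc_edge] by fastforce
  then have ev: "even (length vs)" using assms(1) by (simp add: even_cycle_def)
  have sub: "set vs \<subseteq> W"
  proof
    fix x assume "x \<in> set vs"
    then obtain i where "i < length vs" "x = vs ! i" by (auto simp: in_set_conv_nth)
    then have "x \<in> cyc_edge vs i" "cyc_edge vs i \<in> C" using vs(3) by (auto simp: cyc_edge_def)
    then show "x \<in> W" using assms(2) by blast
  qed
  have "length vs \<le> 5" using card_mono[OF assms(3) sub] distinct_card[OF vs(2)] assms(4) by simp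
  then have "length vs = 3 \<or> length vs = 4 \<or> length vs = 5" using vs(1) by linarith
  then have len: "length vs = 4" using ev by auto
  then obtain a b c d where abcd: "vs = [a, b, c, d]"
    by (auto simp: numeral_eq_Suc length_Suc_conv)
  have "C = square a b c d" unfolding vs(3) abcd by (rule cyc_edge_image_square)
  then show thesis using that vs(2) sub abcd by auto
qed

text \<open>At most one vertex of the second square lies outside the first; rotation brings it to
  the front.\<close>

lemma rotate_square_into:
  assumes "distinct [a, b, c, d]" "distinct [p, q, r, s]" "card ({a, b, c, d} \<union> {p, q, r, s}) \<le> 5"
  obtains p' q' r' s' where "distinct [p', q', r', s']" "square p q r s = square p' q' r' s'"
    "{p', q', r', s'} = {p, q, r, s}" "q' \<in> {a, b, c, d}" "r' \<in> {a, b, c, d}" "s' \<in> {a, b, c, d}"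
proof -
  define A where "A = {a, b, c, d}"
  let ?B = "{p, q, r, s}"
  have "card (A \<union> ?B) = card A + card (?B - A)"
    by (subst card_Un_disjoint[symmetric]) (auto simp: A_def intro: arg_cong[where f = card])
  moreover have "card A = 4" using assms(1) by (simp add: A_def)
  ultimately have "card (?B - A) \<le> Suc 0" using assms(3) by (simp add: A_def)
  moreover have "finite (?B - A)" by simp
  ultimately have same: "\<forall>x \<in> ?B - A. \<forall>y \<in> ?B - A. x = y" using card_le_Suc0_iff_eq by blast
  have h: "x \<in> A \<or> y \<in> A" if "x \<in> ?B" "y \<in> ?B" "x \<noteq> y" for x y using same that by blast
  have "p \<in> A \<or> q \<in> A" "p \<in> A \<or> r \<in> A" "p \<in> A \<or> s \<in> A" "q \<in> A \<or> r \<in> A" "q \<in> A \<or> s \<in> A"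
    "r \<in> A \<or> s \<in> A"
    using h[of p q] h[of p r] h[of p s] h[of q r] h[of q s] h[of r s] assms(2) by simp_all
  then consider "q \<in> A" "r \<in> A" "s \<in> A" | "r \<in> A" "s \<in> A" "p \<in> A"
    | "s \<in> A" "p \<in> A" "q \<in> A" | "p \<in> A" "q \<in> A" "r \<in> A" by argo
  then show thesis
  proof cases
    case 1
    then show thesis using that[of p q r s] assms(2) by (simp add: A_def)
  next
    case 2
    have "square p q r s = square q r s p" by (metis square_rotate)
    then show thesis using that[of q r s p] 2 assms(2) by (auto simp: A_def)
  next
    case 3
    have "square p q r s = square r s p q" by (metis square_rotate)
    then show thesis using that[of r s p q] 3 assms(2) by (auto simp: A_def)
  next
    case 4
    have "square p q r s = square s p q r" by (metis square_rotate)
    then show thesis using that[of s p q r] 4 assms(2) by (auto simp: A_def)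
  qed
qed

text \<open>A vertex of a square has only one opposite vertex, so of the consecutive edges
  \<open>{q', r'}\<close> and \<open>{r', s'}\<close> at most one is a diagonal of the first
  square.\<close>

lemma squares_meet:
  assumes "distinct [a, b, c, d]" "distinct [p, q, r, s]" "card ({a, b, c, d} \<union> {p, q, r, s}) \<le> 5"
  shows "square a b c d \<inter> square p q r s \<noteq> {}"
proof -
  obtain p' q' r' s' where 1: "distinct [p', q', r', s']" "square p q r s = square p' q' r' s'"
    "q' \<in> {a, b, c, d}" "r' \<in> {a, b, c, d}" "s' \<in> {a, b, c, d}"
    using rotate_square_into[OF assms] by metis
  have "{q', r'} \<in> square a b c d \<or> {r', s'} \<in> square a b c d"
    using assms(1) 1(1,3-5) by (auto simp: square_def doubleton_eq_iff)
  moreover have "{q', r'} \<in> square p q r s" "{r', s'} \<in> square p q r s"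
    unfolding 1(2) by (auto simp: square_def)
  ultimately show ?thesis by blast
qed

text \<open>Of two consecutive edges inside \<open>{a, b, c, d}\<close>, one is
  \<open>{a, b}\<close> and the other is the diagonal at their common vertex. That fixes three
  vertices; taking the remaining vertex of the first square as the fourth would create a second
  common edge.\<close>

lemma squares_meet_once:
  assumes "distinct [a, b, c, d]" "distinct [p, q, r, s]" "card ({a, b, c, d} \<union> {p, q, r, s}) \<le> 5"
    and once: "square a b c d \<inter> square p q r s \<subseteq> {{a, b}}"
  shows "\<exists>u \<in> {p, q, r, s} - {a, b, c, d}.
    square p q r s = square a b u c \<or> square p q r s = square b a u d"
proof -
  obtain p' q' r' s' where 1: "distinct [p', q', r', s']" "square p q r s = square p' q' r' s'"
    "{p', q', r', s'} = {p, q, r, s}" "q' \<in> {a, b, c, d}" "r' \<in> {a, b, c, d}" "s' \<in> {a, b, c, d}"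
    using rotate_square_into[OF assms(1-3)] by metis
  have all: "\<forall>e \<in> square p' q' r' s'. e \<in> square a b c d \<longrightarrow> e = {a, b}" using once 1(2) by blast
  have "{q', r'} \<in> square p' q' r' s'" "{r', s'} \<in> square p' q' r' s'"
    "{p', q'} \<in> square p' q' r' s'" "{s', p'} \<in> square p' q' r' s'" by (simp_all add: square_def)
  note e = this[THEN bspec[OF all]]
  have nb: "{x, y} = {a, b} \<or> {x, y} = {a, c} \<or> {x, y} = {b, d}"
    if x: "x \<in> {a, b, c, d}" and y: "y \<in> {a, b, c, d}" and xy: "x \<noteq> y"
      "{x, y} \<in> square a b c d \<longrightarrow> {x, y} = {a, b}" for x y
  proof -
    consider "{x, y} \<in> square a b c d" | "{x, y} = {a, c}" | "{x, y} = {b, d}"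
      using x y xy(1) unfolding square_def by blast
    then show ?thesis by cases (use xy(2) in simp_all)
  qed
  have qrs: "q' = b \<and> r' = a \<and> s' = c \<or> q' = c \<and> r' = a \<and> s' = b \<or>
      q' = a \<and> r' = b \<and> s' = d \<or> q' = d \<and> r' = b \<and> s' = a"
    using nb[OF 1(4,5) _ e(1)] nb[OF 1(5,6) _ e(2)] assms(1) 1(1)
    by (auto simp: doubleton_eq_iff)
  have "p' \<notin> {a, b, c, d}"
  proof
    assume p: "p' \<in> {a, b, c, d}"
    show False
      using nb[OF p 1(4) _ e(3)] nb[OF 1(6) p _ e(4)] assms(1) 1(1) qrs
      by (elim disjE conjE) (auto simp: doubleton_eq_iff)
  qed
  moreover have "square p' q' r' s' = square a b p' c \<or> square p' q' r' s' = square b a p' d"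
    using qrs by (elim disjE) (simp_all add: square_def insert_commute)
  moreover have "p' \<in> {p, q, r, s}" using 1(3) by blast
  ultimately show ?thesis unfolding 1(2) by (intro bexI[of _ p'] DiffI)
qed

lemma rainbow_squareI:
  assumes "distinct [a, b, c, d]" "distinct [i, j, k, l]" "{i, j, k, l} \<subseteq> {..<length D}"
    "{a, b} \<in> D ! i" "{b, c} \<in> D ! j" "{c, d} \<in> D ! k" "{d, a} \<in> D ! l"
  shows "has_rainbow_even_cycle D"
proof -
  define f where "f e = (if e = {a, b} then i else if e = {b, c} then j else if e = {c, d} then k else l)" for e
  have f: "f {a, b} = i" "f {b, c} = j" "f {c, d} = k" "f {d, a} = l"
    using assms(1) by (auto simp: f_def doubleton_eq_iff)
  have "inj_on f (square a b c d)" using f assms(2) by (auto simp: square_def)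
  moreover have "\<forall>e \<in> square a b c d. f e < length D \<and> e \<in> D ! f e"
    using f assms(3-7) by (auto simp: square_def)
  ultimately show ?thesis
    using even_cycle_square[OF assms(1)] unfolding has_rainbow_even_cycle_def by blast
qed

lemma three_elements_if_card_ge:
  assumes "3 \<le> card A"
  obtains x y z where "{x, y, z} \<subseteq> A" "distinct [x, y, z]"
proof -
  obtain B where "B \<subseteq> A" "card B = 3" using obtain_subset_with_card_n[OF assms] by blast
  then show thesis using that by (auto simp: card_3_iff)
qed

text \<open>Two of the three cycles coincide, say both are \<open>square a b u c\<close>. If the
  third agrees, that square is rainbow with \<open>{a, b}\<close> taken from \<open>D ! i\<close>.
  Otherwise \<open>square b u c d\<close> is rainbow: two edges from the equal pair,
  \<open>{c, d}\<close> from \<open>D ! i\<close> and \<open>{d, b}\<close> from the third. The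
  other case follows by exchanging \<open>a\<close> with \<open>b\<close> and \<open>c\<close> with
  \<open>d\<close>.\<close>

lemma rainbow_if_three_meet_once:
  assumes "distinct [a, b, c, d]" "u \<notin> {a, b, c, d}" "D ! i = square a b c d"
    and J: "{x, y, z} \<subseteq> J" "distinct [x, y, z]" "i \<notin> J" "insert i J \<subseteq> {..<length D}"
    and X: "\<And>j. j \<in> J \<Longrightarrow> D ! j = square a b u c \<or> D ! j = square b a u d"
  shows "has_rainbow_even_cycle D"
proof -
  have ne: "distinct [i, x, y, z]" "{i, x, y, z} \<subseteq> {..<length D}" using J by auto
  have three: "has_rainbow_even_cycle D"
    if "D ! r = square a' b' u c'" "D ! s = square a' b' u c'" "D ! t = square a' b' u c' \<or> D ! t = square b' a' u d'"
      "distinct [i, r, s, t]" "{i, r, s, t} \<subseteq> {..<length D}" "distinct [a', b', c', d']" "u \<notin> {a', b', c', d'}"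
      "{a', b'} \<in> D ! i" "{c', d'} \<in> D ! i" for r s t a' b' c' d'
    using that(3)
  proof
    assume t: "D ! t = square a' b' u c'"
    show ?thesis
      by (rule rainbow_squareI[of a' b' u c' i r s t]) (use that t in \<open>auto simp: square_def\<close>)
  next
    assume t: "D ! t = square b' a' u d'"
    show ?thesis
      by (rule rainbow_squareI[of b' u c' d' r s i t]) (use that t in \<open>auto simp: square_def insert_commute\<close>)
  qed
  have i: "{a, b} \<in> D ! i" "{b, a} \<in> D ! i" "{c, d} \<in> D ! i" "{d, c} \<in> D ! i"
    using assms(3) by (auto simp: square_def)
  have X': "D ! x = square a b u c \<or> D ! x = square b a u d"
    "D ! y = square a b u c \<or> D ! y = square b a u d"
    "D ! z = square a b u c \<or> D ! z = square b a u d" using X J(1) by auto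
  have d: "distinct [a, b, c, d]" "distinct [b, a, d, c]" "u \<notin> {a, b, c, d}" "u \<notin> {b, a, d, c}"
    using assms(1,2) by auto
  have pair: "has_rainbow_even_cycle D"
    if "D ! r = D ! s" "distinct [i, r, s, t]" "{i, r, s, t} \<subseteq> {..<length D}" "{r, s, t} \<subseteq> J" for r s t
  proof -
    have r: "D ! r = square a b u c \<or> D ! r = square b a u d"
      and t: "D ! t = square a b u c \<or> D ! t = square b a u d" using X that(4) by auto
    from r show ?thesis
    proof
      assume "D ! r = square a b u c"
      then show ?thesis using three[of r a b c s t d] that t d i by simp
    next
      assume "D ! r = square b a u d"
      then show ?thesis using three[of r b a d s t c] that t d i by auto
    qed
  qed
  have "D ! x = D ! y \<or> D ! x = D ! z \<or> D ! y = D ! z" using X' by metis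
  then show ?thesis using pair[of x y z] pair[of x z y] pair[of y z x] ne J(1) by auto
qed

lemma rainbow_if_dense:
  assumes W: "finite W" "card W \<le> 5" and C: "C \<subseteq> {..<length D}" "C \<noteq> {}" "card W \<le> card C"
    and DC: "\<And>j. j \<in> C \<Longrightarrow> even_cycle (D ! j) \<and> \<Union>(D ! j) \<subseteq> W"
  shows "has_rainbow_even_cycle D"
proof (rule ccontr)
  assume no: "\<not> has_rainbow_even_cycle D"
  have finC: "finite C" using C(1) finite_subset by blast
  have sq: "\<exists>a b c d. distinct [a, b, c, d] \<and> {a, b, c, d} \<subseteq> W \<and> D ! j = square a b c d"
    if "j \<in> C" for j
    using square_if_even_cycle[of "D ! j" W] DC[OF that] W by metis
  have card4: "card (D ! j) = 4" if "j \<in> C" for j using sq[OF that] card_square by metis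
  have "card W \<ge> 4"
  proof -
    obtain j where "j \<in> C" using C(2) by blast
    then obtain a b c d where "distinct [a, b, c, d]" "{a, b, c, d} \<subseteq> W" using sq by blast
    then show ?thesis using card_mono[OF W(1), of "{a, b, c, d}"] by auto
  qed
  have meet: "D ! i \<inter> D ! j \<noteq> {}" if ij: "i \<in> C" "j \<in> C" for i j
  proof -
    obtain a b c d where 1: "distinct [a, b, c, d]" "{a, b, c, d} \<subseteq> W" "D ! i = square a b c d"
      using sq[OF ij(1)] by blast
    obtain p q r s where 2: "distinct [p, q, r, s]" "{p, q, r, s} \<subseteq> W" "D ! j = square p q r s"
      using sq[OF ij(2)] by blast
    have "card ({a, b, c, d} \<union> {p, q, r, s}) \<le> card W" using 1 2 W(1) by (intro card_mono) auto
    then show ?thesis using squares_meet[OF 1(1) 2(1)] 1(3) 2(3) W(2) by simp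
  qed
  define P where "P i = {e \<in> D ! i. \<forall>j \<in> C - {i}. e \<notin> D ! j}" for i
  have finD: "finite (D ! i)" if "i \<in> C" for i
    using card4[OF that] card.infinite by fastforce
  have P2: "2 \<le> card (P i)" if i: "i \<in> C" for i
  proof -
    let ?A = "\<lambda>e. {j \<in> C. e \<in> D ! j}"
    \<comment> \<open>Since \<open>D ! i\<close> itself cannot be made rainbow, Hall's condition
      fails for its edges: some \<open>J\<close> sees fewer colours than it has edges, and
      \<open>i\<close> is always among those seen.\<close>
    have "\<not> (\<exists>f. inj_on f (D ! i) \<and> (\<forall>e \<in> D ! i. f e \<in> ?A e))"
      using no DC[OF i] C(1) unfolding has_rainbow_even_cycle_def by blast
    then have "\<not> (\<forall>J. J \<subseteq> D ! i \<longrightarrow> card J \<le> card (\<Union>(?A ` J)))"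
      using hall_marriage[OF finD[OF i], of ?A] finC by auto
    then obtain J where J: "J \<subseteq> D ! i" "card (\<Union>(?A ` J)) < card J" by (auto simp: not_le)
    let ?N = "\<Union>(?A ` J)"
    have finJ: "finite J" using J(1) finD[OF i] finite_subset by blast
    have finN: "finite ?N" using finC by (auto intro: finite_subset)
    have "J \<noteq> {}" using J(2) by auto
    then have iN: "i \<in> ?N" using i J(1) by auto
    then have "card ?N > 0" using finN card_gt_0_iff by blast
    moreover have "card J \<le> 4" using card_mono[OF finD[OF i] J(1)] card4[OF i] by simp
    ultimately consider "card J = 2" | "card J = 3" | "card J = 4" using J(2) by linarith
    then show ?thesis
    proof cases
      case 1
      then have "card ?N = 1" using J(2) \<open>card ?N > 0\<close> by linarith
      then have "?N = {i}" using iN by (metis card_1_singletonE singletonD)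
      then have "J \<subseteq> P i" using J(1) by (auto simp: P_def)
      then show ?thesis using 1 card_mono[of "P i" J] finD[OF i] by (simp add: P_def)
    next
      case 2
      \<comment> \<open>Three edges see at most one colour besides \<open>i\<close>, so all other
        cycles, at least \<open>card C - 2\<close> of them, can meet \<open>D ! i\<close> only in
        its fourth edge \<open>e\<close>.\<close>
      have "card (D ! i - J) = 1" using 2 J(1) finJ card4[OF i] by (simp add: card_Diff_subset)
      then obtain e where e: "D ! i - J = {e}" by (auto simp: card_1_singleton_iff)
      obtain a b c d where 1: "distinct [a, b, c, d]" "{a, b, c, d} \<subseteq> W" "D ! i = square a b c d" "e = {a, b}"
      proof -
        obtain a b c d where s: "distinct [a, b, c, d]" "{a, b, c, d} \<subseteq> W" "D ! i = square a b c d"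
          using sq[OF i] by blast
        then have "e \<in> square a b c d" using e by auto
        then have "e = {a, b} \<or> e = {b, c} \<or> e = {c, d} \<or> e = {d, a}" by (auto simp: square_def)
        moreover have "D ! i = square b c d a" "D ! i = square c d a b" "D ! i = square d a b c"
          using s(3) by (metis square_rotate)+
        moreover have "distinct [b, c, d, a]" "distinct [c, d, a, b]" "distinct [d, a, b, c]"
          "{b, c, d, a} \<subseteq> W" "{c, d, a, b} \<subseteq> W" "{d, a, b, c} \<subseteq> W" using s(1,2) by auto
        ultimately show thesis
          using that[OF s] that[of b c d a] that[of c d a b] that[of d a b c] by (elim disjE) simp_all
      qed
      have once: "\<exists>u \<in> W - {a, b, c, d}. D ! j = square a b u c \<or> D ! j = square b a u d"
        if j: "j \<in> C - ?N" for j
      proof -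
        obtain p q r s where 3: "distinct [p, q, r, s]" "{p, q, r, s} \<subseteq> W" "D ! j = square p q r s"
          using sq[of j] DiffD1[OF j] by blast
        have "card ({a, b, c, d} \<union> {p, q, r, s}) \<le> card W" using 1 3 W(1) by (intro card_mono) auto
        then have c5: "card ({a, b, c, d} \<union> {p, q, r, s}) \<le> 5" using W(2) by linarith
        have "D ! i \<inter> D ! j \<subseteq> {e}" using j e by auto
        then have "square a b c d \<inter> square p q r s \<subseteq> {{a, b}}" using 1 3 by simp
        then show ?thesis using squares_meet_once[OF 1(1) 3(1) c5] 3 by auto
      qed
      have NC: "?N \<subseteq> C" by auto
      have cardN: "card (C - ?N) + 2 \<ge> card C"
        using card_Diff_subset[OF finN NC] J(2) 2 by linarith
      then have "C - ?N \<noteq> {}" using \<open>card W \<ge> 4\<close> C(3) by (cases "C - ?N = {}") simp_all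
      \<comment> \<open>Such a cycle uses a fifth vertex. This forces \<open>card W = 5\<close>,
        hence at least five colours in \<open>C\<close> and at least three outside
        \<open>?N\<close>.\<close>
      then obtain u where u: "u \<in> W - {a, b, c, d}" using once by blast
      have "card (insert u {a, b, c, d}) = 5" using u 1(1) by auto
      moreover have sub: "insert u {a, b, c, d} \<subseteq> W" using u 1(2) by auto
      ultimately have W5: "insert u {a, b, c, d} = W"
        using W card_mono[OF W(1) sub] by (intro card_subset_eq) auto
      then have "card W = 5" using \<open>card (insert u {a, b, c, d}) = 5\<close> by simp
      then have "3 \<le> card (C - ?N)" using cardN C(3) by linarith
      then obtain x y z where xyz: "{x, y, z} \<subseteq> C - ?N" "distinct [x, y, z]"
        by (rule three_elements_if_card_ge)
      have "D ! j = square a b u c \<or> D ! j = square b a u d" if "j \<in> C - ?N" for j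
        using once[OF that] W5 by auto
      then have "has_rainbow_even_cycle D"
        using u 1 iN C(1) i xyz by (intro rainbow_if_three_meet_once[of a b c d u D i x y z "C - ?N"]) auto
      then show ?thesis using no by simp
    next
      case 3
      then have "J = D ! i" using card_subset_eq[OF finD[OF i] J(1)] card4[OF i] by simp
      \<comment> \<open>Every cycle of \<open>C\<close> meets \<open>D ! i\<close>, so its four
        edges see all of \<open>C\<close>, which has at least four colours.\<close>
      then have "?N = C" using meet[OF i] by blast
      then have False using J(2) 3 C(3) \<open>card W \<ge> 4\<close> by simp
      then show ?thesis ..
    qed
  qed
  have "2 \<le> card C" using C(3) \<open>card W \<ge> 4\<close> by linarith
  then obtain i j where ij: "i \<in> C" "j \<in> C" "i \<noteq> j"
    by (metis card_le_Suc0_iff_eq finC not_less_eq_eq numeral_2_eq_2)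
  \<comment> \<open>An edge common to two cycles is private to none. Leaving it out is what settles
    \<open>card W = 5\<close>, where ten private edges would exactly fill the ten pairs.\<close>
  obtain e where e: "e \<in> D ! i" "e \<in> D ! j" using meet[OF ij(1,2)] by blast
  let ?E = "{B. B \<subseteq> W \<and> card B = 2}"
  have PE: "\<Union>(P ` C) \<subseteq> ?E - {e}"
  proof (rule UN_least)
    fix h assume h: "h \<in> C"
    show "P h \<subseteq> ?E - {e}"
    proof
      fix d assume d: "d \<in> P h"
      then have "d \<in> D ! h" by (simp add: P_def)
      then have "card d = 2" "d \<subseteq> W"
        using DC[OF h] is_cycle_edge_card by (auto simp: even_cycle_def)
      moreover have "d \<noteq> e" using d e ij by (auto simp: P_def)
      ultimately show "d \<in> ?E - {e}" by simp
    qed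
  qed
  have finE: "finite ?E" using W(1) by simp
  have eE: "e \<in> ?E" using e(1) DC[OF ij(1)] is_cycle_edge_card by (auto simp: even_cycle_def)
  have "2 * card C \<le> (\<Sum>h \<in> C. card (P h))" using sum_bounded_below[of C 2 "\<lambda>h. card (P h)"] P2 by simp
  also have "\<dots> = card (\<Union>(P ` C))"
    using finC finD by (intro card_UN_disjoint[symmetric]) (auto simp: P_def)
  also have "\<dots> \<le> card (?E - {e})" using finE PE by (intro card_mono) auto
  also have "\<dots> = (card W choose 2) - 1" using eE finE n_subsets[OF W(1), of 2] by simp
  finally have "2 * card W \<le> (card W choose 2) - 1" using C(3) by linarith
  moreover have "card W = 4 \<or> card W = 5" using \<open>card W \<ge> 4\<close> W(2) by linarith
  ultimately show False by (auto simp: choose_two)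
qed

section \<open>Swapping edges in maximum rainbow forests\<close>

text \<open>Up to complement a cut of \<open>V\<close> is a subset of \<open>V - {v}\<close>, so
  there are at most \<open>2 ^ (card V - 1)\<close> cuts, while \<open>2 ^ card K\<close> different
  traces must be realised.\<close>

lemma card_le_if_all_cuts:
  assumes "finite V" "v \<in> V" "finite K" "\<And>i. i \<in> K \<Longrightarrow> e i \<subseteq> V"
    and cuts: "\<And>G. G \<subseteq> K \<Longrightarrow> \<exists>X. \<forall>i \<in> K. crosses (e i) X \<longleftrightarrow> i \<in> G"
  shows "card K \<le> card V - 1"
proof -
  have "\<exists>X \<subseteq> V - {v}. \<forall>i \<in> K. crosses (e i) X \<longleftrightarrow> i \<in> G" if G: "G \<subseteq> K" for G
  proof -
    obtain X where X: "\<forall>i \<in> K. crosses (e i) X \<longleftrightarrow> i \<in> G" using cuts[OF G] by blast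
    define Y where "Y = (if v \<in> X then V - X else V \<inter> X)"
    have "crosses (e i) Y \<longleftrightarrow> crosses (e i) X" if "i \<in> K" for i
      using assms(4)[OF that] by (auto simp: Y_def crosses_def)
    moreover have "Y \<subseteq> V - {v}" by (auto simp: Y_def)
    ultimately show ?thesis using X by metis
  qed
  then obtain c where c: "\<And>G. G \<subseteq> K \<Longrightarrow> c G \<subseteq> V - {v}"
    "\<And>G i. G \<subseteq> K \<Longrightarrow> i \<in> K \<Longrightarrow> crosses (e i) (c G) \<longleftrightarrow> i \<in> G" by metis
  have "inj_on c (Pow K)"
  proof (rule inj_onI)
    fix G H assume "G \<in> Pow K" "H \<in> Pow K" "c G = c H"
    then show "G = H" using c(2)[of G] c(2)[of H] by auto
  qed
  moreover have "c ` Pow K \<subseteq> Pow (V - {v})" using c(1) by auto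
  ultimately have "card (Pow K) \<le> card (Pow (V - {v}))"
    using assms(1) by (intro card_inj_on_le) auto
  then have "(2::nat) ^ card K \<le> 2 ^ (card V - 1)"
    using assms(1,2,3) by (simp add: card_Pow)
  then show ?thesis by simp
qed

locale rainbow_even_free =
  fixes V :: "'a set" and D :: "'a set set list"
  assumes fin: "finite V"
    and even_cycles: "\<And>i. i < length D \<Longrightarrow> even_cycle (D ! i)"
    and in_V: "\<And>i. i < length D \<Longrightarrow> \<Union>(D ! i) \<subseteq> V"
    and no_rainbow: "\<not> has_rainbow_even_cycle D"
begin

lemma cycleD: "i < length D \<Longrightarrow> is_cycle (D ! i)"
  using even_cycles by (auto simp: even_cycle_def)

lemma edge_card: "i < length D \<Longrightarrow> f \<in> D ! i \<Longrightarrow> card f = 2"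
  using cycleD is_cycle_edge_card by blast

text \<open>A rainbow forest is given by the set \<open>K\<close> of its colours and the map \<open>e\<close> from colours to edges.
  That it is acyclic is expressed by cuts: every edge is the only forest edge crossing some cut.\<close>

definition separates :: "nat set \<Rightarrow> (nat \<Rightarrow> 'a set) \<Rightarrow> nat \<Rightarrow> 'a set \<Rightarrow> bool" where
  "separates K e j S \<longleftrightarrow> (\<forall>i \<in> K. crosses (e i) S \<longleftrightarrow> i = j)"

definition rainbow_forest :: "nat set \<Rightarrow> (nat \<Rightarrow> 'a set) \<Rightarrow> bool" where
  "rainbow_forest K e \<longleftrightarrow> K \<subseteq> {..<length D} \<and> (\<forall>i \<in> K. e i \<in> D ! i) \<and>
    (\<forall>j \<in> K. \<exists>S. separates K e j S)"

definition max_forest :: "nat set \<Rightarrow> (nat \<Rightarrow> 'a set) \<Rightarrow> bool" where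
  "max_forest K e \<longleftrightarrow> rainbow_forest K e \<and> (\<forall>K' e'. rainbow_forest K' e' \<longrightarrow> card K' \<le> card K)"

section \<open>Maximum rainbow forests and their missing colours\<close>

lemma forest_finite: "rainbow_forest K e \<Longrightarrow> finite K"
  by (auto simp: rainbow_forest_def intro: finite_subset)

lemma forest_edge_card: "rainbow_forest K e \<Longrightarrow> i \<in> K \<Longrightarrow> card (e i) = 2"
  using edge_card by (auto simp: rainbow_forest_def subset_eq)

lemma forest_separator:
  assumes "rainbow_forest K e" "j \<in> K"
  obtains S where "separates K e j S"
  using assms by (auto simp: rainbow_forest_def)

lemma forest_inj:
  assumes "rainbow_forest K e" shows "inj_on e K"
proof (rule inj_onI)
  fix i j assume ij: "i \<in> K" "j \<in> K" "e i = e j"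
  then obtain S where "separates K e i S" using assms by (auto simp: rainbow_forest_def)
  then show "i = j" using ij unfolding separates_def by metis
qed

text \<open>Separating cuts are added up over \<open>G\<close>. For \<open>G = K\<close> the result
  is a bipartition of the forest.\<close>

lemma forest_cut:
  assumes F: "rainbow_forest K e" and "G \<subseteq> K"
  shows "\<exists>X. \<forall>i \<in> K. crosses (e i) X \<longleftrightarrow> i \<in> G"
proof -
  have "finite G" using F assms(2) forest_finite finite_subset by blast
  then show ?thesis using assms(2)
  proof (induction G rule: finite_induct)
    case empty
    show ?case by (intro exI[of _ "{}"]) (auto simp: crosses_def)
  next
    case (insert j G)
    then obtain X where X: "\<forall>i \<in> K. crosses (e i) X \<longleftrightarrow> i \<in> G" by auto
    obtain S where S: "\<forall>i \<in> K. crosses (e i) S \<longleftrightarrow> i = j"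
      using F insert.prems by (auto simp: rainbow_forest_def separates_def)
    have "crosses (e i) ((X - S) \<union> (S - X)) \<longleftrightarrow> i \<in> insert j G" if "i \<in> K" for i
      using X S that insert.hyps(2) by (auto simp: crosses_sym_diff[OF forest_edge_card[OF F that]])
    then show ?case by blast
  qed
qed

lemma forest_card_le:
  assumes "rainbow_forest K e" "V \<noteq> {}"
  shows "card K \<le> card V - 1"
proof -
  obtain v where "v \<in> V" using assms(2) by blast
  moreover have "e i \<subseteq> V" if "i \<in> K" for i
    using assms(1) that in_V[of i] by (auto simp: rainbow_forest_def subset_eq)
  ultimately show ?thesis
    using card_le_if_all_cuts[of V v K e] fin forest_finite[OF assms(1)] forest_cut[OF assms(1)] by blast
qed

lemma max_forest_exists: "\<exists>K e. max_forest K e"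
proof -
  let ?P = "\<lambda>(K, e). rainbow_forest K e" and ?f = "\<lambda>(K, e). card K"
  have "?P ({}, e)" for e by (auto simp: rainbow_forest_def)
  moreover have "?f p < Suc (length D)" if "?P p" for p
    using that card_mono[of "{..<length D}" "fst p"] by (auto simp: rainbow_forest_def split: prod.splits)
  ultimately obtain p where "?P p" "\<And>q. ?P q \<Longrightarrow> ?f q \<le> ?f p"
    using ex_has_greatest_nat[of ?P _ ?f "Suc (length D)"] by (metis (no_types, lifting))
  then show ?thesis by (cases p) (force simp: max_forest_def)
qed

text \<open>Otherwise the edge could join the forest with colour \<open>k\<close>. The component of
  \<open>u\<close> separates it, and an old separating cut that it crosses is repaired by adding
  this component.\<close>

lemma missing_connected:
  assumes mf: "max_forest K e" and k: "k < length D" "k \<notin> K" and f: "{u, v} \<in> D ! k"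
  shows "(u, v) \<in> (adj (e ` K))\<^sup>*"
proof (rule ccontr)
  assume nc: "\<not> ?thesis"
  let ?U = "{x. (u, x) \<in> (adj (e ` K))\<^sup>*}"
  let ?e = "e(k := {u, v})" and ?K = "insert k K"
  have F: "rainbow_forest K e" using mf by (simp add: max_forest_def)
  have U: "\<not> crosses (e i) ?U" if i: "i \<in> K" for i
    using uncut_component[OF forest_edge_card[OF F i]] i by simp
  have cU: "crosses {u, v} ?U" using nc by auto
  have "separates ?K ?e k ?U" using U cU k(2) by (auto simp: separates_def simp del: crosses_pair)
  moreover have "\<exists>S. separates ?K ?e j S" if j: "j \<in> K" for j
  proof -
    obtain S where S: "separates K e j S" using F j by (auto simp: rainbow_forest_def)
    show ?thesis
    proof (cases "crosses {u, v} S")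
      case False
      then show ?thesis using S k(2) j
        by (intro exI[of _ S]) (auto simp: separates_def simp del: crosses_pair)
    next
      case True
      have *: "crosses {u, v} ((S - ?U) \<union> (?U - S)) \<longleftrightarrow> crosses {u, v} S \<noteq> crosses {u, v} ?U"
        using edge_card[OF k(1) f] by (rule crosses_sym_diff)
      have "crosses (e i) ((S - ?U) \<union> (?U - S)) \<longleftrightarrow> i = j" if "i \<in> K" for i
        using S U[OF that] that by (simp add: crosses_sym_diff[OF forest_edge_card[OF F that]] separates_def)
      then show ?thesis using True cU * k(2) j
        by (intro exI[of _ "(S - ?U) \<union> (?U - S)"]) (auto simp: separates_def simp del: crosses_pair)
    qed
  qed
  ultimately have "rainbow_forest ?K ?e"
    using F f k by (auto simp: rainbow_forest_def)
  then have "card ?K \<le> card K" using mf unfolding max_forest_def by blast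
  then show False using k(2) forest_finite[OF F] by simp
qed

lemma missing_uncut:
  assumes mf: "max_forest K e" and k: "k < length D" "k \<notin> K" "f \<in> D ! k"
    and X: "\<And>i. i \<in> K \<Longrightarrow> \<not> crosses (e i) X"
  shows "\<not> crosses f X"
proof -
  obtain u v where f: "f = {u, v}" using edge_card[OF k(1,3)] by (auto simp: card_2_iff)
  have "(u, v) \<in> (adj (e ` K))\<^sup>*" using missing_connected[OF mf k(1,2)] k(3) f by blast
  then have "u \<in> X \<longleftrightarrow> v \<in> X"
  proof (induction rule: rtrancl_induct)
    case (step y z)
    then obtain i where "i \<in> K" "e i = {y, z}" by (auto simp: adj_def)
    then show ?case using X[of i] step by auto
  qed simp
  then show ?thesis using f by simp
qed

text \<open>Forest edges keep their own colours and \<open>f\<close> takes the missing colour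
  \<open>k\<close>. The cycle is thus rainbow and cannot be even.\<close>

lemma fundamental_cycle:
  assumes mf: "max_forest K e" and k: "k < length D" "k \<notin> K" "f \<in> D ! k" and f: "f \<notin> e ` K"
  obtains Q where "Q \<subseteq> K" "is_cycle (insert f (e ` Q))" "odd (card (insert f (e ` Q)))"
proof -
  obtain u v where uv: "f = {u, v}" "u \<noteq> v"
    using edge_card[OF k(1,3)] by (auto simp: card_2_iff)
  obtain Q' where Q': "Q' \<subseteq> e ` K" "is_cycle (insert {u, v} Q')"
    using cycle_if_connected[of u v "e ` K"] missing_connected[OF mf k(1,2)] k(3) f uv by metis
  obtain Q where Q: "Q \<subseteq> K" "Q' = e ` Q" using Q'(1) by (meson subset_imageE)
  let ?C = "insert f (e ` Q)"
  have F: "rainbow_forest K e" using mf by (simp add: max_forest_def)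
  have C: "is_cycle ?C" using Q' Q uv by simp
  have "odd (card ?C)"
  proof (rule ccontr)
    assume "\<not> odd (card ?C)"
    then have "even_cycle ?C" using C by (simp add: even_cycle_def)
    define c where "c d = (if d = f then k else the_inv_into K e d)" for d
    have inv: "c (e i) = i" if "i \<in> Q" for i
      using that Q f the_inv_into_f_f[OF forest_inj[OF F]] by (auto simp: c_def)
    have "inj_on c ?C"
    proof (rule inj_onI)
      fix x y assume "x \<in> ?C" "y \<in> ?C" "c x = c y"
      moreover have "c f = k" by (simp add: c_def)
      ultimately show "x = y" using inv k(2) Q(1) by auto
    qed
    moreover have "c d < length D \<and> d \<in> D ! c d" if d: "d \<in> ?C" for d
    proof (cases "d = f")
      case True
      then show ?thesis using k by (simp add: c_def)
    next
      case False
      then obtain i where "i \<in> Q" "d = e i" using d by blast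
      then show ?thesis using inv[of i] Q(1) F by (auto simp: rainbow_forest_def)
    qed
    ultimately have "has_rainbow_even_cycle D"
      unfolding has_rainbow_even_cycle_def using \<open>even_cycle ?C\<close> by (intro exI[of _ ?C] exI[of _ c]) simp
    then show False using no_rainbow by simp
  qed
  then show thesis using that Q C by blast
qed

text \<open>\<open>X\<close> is a bipartition of the forest. If \<open>f\<close> crossed it too, all
  edges of its odd fundamental cycle would.\<close>

lemma missing_same_side:
  assumes mf: "max_forest K e" and k: "k < length D" "k \<notin> K" "f \<in> D ! k" and f: "f \<notin> e ` K"
    and X: "\<And>i. i \<in> K \<Longrightarrow> crosses (e i) X"
  shows "\<not> crosses f X"
proof
  assume fX: "crosses f X"
  obtain Q where Q: "Q \<subseteq> K" "is_cycle (insert f (e ` Q))" "odd (card (insert f (e ` Q)))"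
    using fundamental_cycle[OF mf k f] by blast
  have "{d \<in> insert f (e ` Q). crosses d X} = insert f (e ` Q)" using fX X Q(1) by auto
  then show False using even_card_cycle_cut[OF Q(2), of X] Q(3) by simp
qed

text \<open>The missing colour \<open>k\<close> enters the forest and \<open>j\<close> becomes missing. The map \<open>e'\<close> keeps the stale
  value at \<open>j\<close>, so that swaps at different colours commute on the nose.\<close>

definition swap where
  "swap K e k K' e' j \<longleftrightarrow> k < length D \<and> k \<notin> K \<and> j \<in> K \<and>
    (\<exists>f S. f \<in> D ! k \<and> f \<notin> e ` K \<and> separates K e j S \<and> crosses f S \<and>
       K' = insert k (K - {j}) \<and> e' = e(k := f))"

text \<open>The cut \<open>S\<close> passes from \<open>e j\<close> to \<open>f\<close>. Another
  separating cut \<open>T\<close> crossed by \<open>f\<close> is replaced by its sum with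
  \<open>S\<close>; among the old edges this newly affects only \<open>e j\<close>, which has
  left.\<close>

lemma swap_max_forest:
  assumes mf: "max_forest K e" and k: "k < length D" "k \<notin> K" and j: "j \<in> K" and f: "f \<in> D ! k"
    and S: "separates K e j S" "crosses f S"
  shows "max_forest (insert k (K - {j})) (e(k := f))"
proof -
  let ?K = "insert k (K - {j})" and ?e = "e(k := f)"
  have F: "rainbow_forest K e" using mf by (simp add: max_forest_def)
  have "separates ?K ?e k S" using S k j by (auto simp: separates_def)
  moreover have "\<exists>T. separates ?K ?e i T" if i: "i \<in> K - {j}" for i
  proof -
    obtain T where T: "separates K e i T" using F i by (auto simp: rainbow_forest_def)
    show ?thesis
    proof (cases "crosses f T")
      case False
      then show ?thesis using T k(2) i by (intro exI[of _ T]) (auto simp: separates_def)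
    next
      case True
      let ?T = "(T - S) \<union> (S - T)"
      have "\<not> crosses f ?T" using True S(2) by (simp add: crosses_sym_diff[OF edge_card[OF k(1) f]])
      moreover have "crosses (e h) ?T \<longleftrightarrow> h = i" if "h \<in> K - {j}" for h
        using that T S(1) forest_edge_card[OF F, of h] by (simp add: crosses_sym_diff separates_def)
      ultimately show ?thesis using k(2) i by (intro exI[of _ ?T]) (auto simp: separates_def)
    qed
  qed
  ultimately have "rainbow_forest ?K ?e" using F k f by (auto simp: rainbow_forest_def)
  moreover have "card ?K = card K"
    using k(2) card_Suc_Diff1[OF forest_finite[OF F] j] forest_finite[OF F] by simp
  ultimately show ?thesis using mf by (auto simp: max_forest_def)
qed

lemma max_forest_if_swap: "max_forest K e \<Longrightarrow> swap K e k K' e' j \<Longrightarrow> max_forest K' e'"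
  using swap_max_forest unfolding swap_def by blast

text \<open>If \<open>f \<noteq> g\<close>, then swapping \<open>f\<close> in for \<open>e j\<close> flips the bipartition on one side of \<open>S\<close>, and \<open>g\<close>
  closes an even cycle. If \<open>f = g\<close> is the only candidate, then the whole fundamental cycle of \<open>f\<close>
  lies in \<open>D ! k\<close>, although its length is odd.\<close>

lemma missing_not_both_cross:
  assumes mf: "max_forest K e" and k: "k < length D" "k \<notin> K" and l: "l < length D" "l \<notin> K"
    and "k \<noteq> l" and f: "f \<in> D ! k" "f \<notin> e ` K" and g: "g \<in> D ! l" "g \<notin> e ` K"
    and j: "j \<in> K" and S: "separates K e j S" "crosses f S" "crosses g S"
  shows False
proof -
  have F: "rainbow_forest K e" using mf by (simp add: max_forest_def)
  obtain X where X: "\<And>i. i \<in> K \<Longrightarrow> crosses (e i) X" using forest_cut[OF F order_refl] by blast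
  \<comment> \<open>Kept general in \<open>h\<close>, \<open>i\<close> and \<open>T\<close>, because
    it is applied again below to every edge of the fundamental cycle of \<open>f\<close>.\<close>
  have eq: "h = g" if h: "h \<in> D ! k" "h \<notin> e ` K" and i: "i \<in> K"
    and T: "separates K e i T" "crosses h T" "crosses g T" for h i T
  proof (rule ccontr)
    assume "h \<noteq> g"
    let ?K = "insert k (K - {i})" and ?e = "e(k := h)" and ?X = "(X - T) \<union> (T - X)"
    have mf': "max_forest ?K ?e" using swap_max_forest[OF mf k i h(1) T(1,2)] .
    have "\<not> crosses h X" using missing_same_side[OF mf k h X] .
    then have "crosses h ?X" using T(2) by (simp add: crosses_sym_diff[OF edge_card[OF k(1) h(1)]])
    moreover have "crosses (e i') ?X" if "i' \<in> K - {i}" for i'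
      using that X T(1) forest_edge_card[OF F, of i'] by (simp add: crosses_sym_diff separates_def)
    ultimately have X': "\<And>i'. i' \<in> ?K \<Longrightarrow> crosses (?e i') ?X" using k(2) by auto
    have "\<not> crosses g X" using missing_same_side[OF mf l g X] .
    then have "crosses g ?X" using T(3) by (simp add: crosses_sym_diff[OF edge_card[OF l(1) g(1)]])
    moreover have "l \<notin> ?K" using l(2) \<open>k \<noteq> l\<close> by auto
    moreover have "g \<notin> ?e ` ?K" using g(2) \<open>h \<noteq> g\<close> k(2) by auto
    ultimately show False using missing_same_side[OF mf' l(1) _ g(1) _ X'] by blast
  qed
  have fg: "f = g" using eq[OF f j S] .
  obtain Q where Q: "Q \<subseteq> K" "is_cycle (insert f (e ` Q))" "odd (card (insert f (e ` Q)))"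
    using fundamental_cycle[OF mf k f] by blast
  have "e i \<in> D ! k" if i: "i \<in> Q" for i
  proof -
    obtain T where T: "separates K e i T" using forest_separator[OF F] i Q(1) by blast
    have "crosses (e i) T" using T i Q(1) by (auto simp: separates_def)
    then obtain d where "d \<in> insert f (e ` Q)" "d \<noteq> e i" "crosses d T"
      using cycle_cut_other_edge[OF Q(2), of "e i" T] i by auto
    then have fT: "crosses f T" using T Q(1) by (auto simp: separates_def)
    \<comment> \<open>The cycle \<open>D ! k\<close> crosses \<open>T\<close> a second time. By
      \<open>eq\<close> this cannot happen outside the forest, and the only forest edge across
      \<open>T\<close> is \<open>e i\<close>.\<close>
    obtain d where d: "d \<in> D ! k" "d \<noteq> f" "crosses d T"
      using cycle_cut_other_edge[OF cycleD[OF k(1)] f(1) fT] by blast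
    have "d \<in> e ` K" using eq[OF d(1) _ _ T d(3)] fT d(2) fg i Q(1) by auto
    then have "d = e i" using d(3) T by (auto simp: separates_def)
    then show ?thesis using d(1) by simp
  qed
  then have "insert f (e ` Q) = D ! k"
    using f(1) by (intro is_cycle_subset_eq[OF Q(2) cycleD[OF k(1)]]) auto
  then show False using Q(3) even_cycles[OF k(1)] by (simp add: even_cycle_def)
qed

text \<open>Neither new edge crosses the cut of the other swap, so each cut survives the other swap.
  If both swaps freed the same colour, the sum of the two cuts would miss the forest and yet be
  crossed by \<open>f\<close>.\<close>

lemma swap_diamond:
  assumes mf: "max_forest K e" and "k \<noteq> l"
    and 1: "swap K e k K1 e1 j" and 2: "swap K e l K2 e2 i"
  shows "j \<noteq> i \<and> (\<exists>K3 e3. swap K1 e1 l K3 e3 i \<and> swap K2 e2 k K3 e3 j)"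
proof -
  obtain f S where f: "f \<in> D ! k" "f \<notin> e ` K" "separates K e j S" "crosses f S"
      "K1 = insert k (K - {j})" "e1 = e(k := f)" and k: "k < length D" "k \<notin> K" "j \<in> K"
    using 1 by (auto simp: swap_def)
  obtain g T where g: "g \<in> D ! l" "g \<notin> e ` K" "separates K e i T" "crosses g T"
      "K2 = insert l (K - {i})" "e2 = e(l := g)" and l: "l < length D" "l \<notin> K" "i \<in> K"
    using 2 by (auto simp: swap_def)
  have F: "rainbow_forest K e" using mf by (simp add: max_forest_def)
  have gS: "\<not> crosses g S"
    using missing_not_both_cross[OF mf k(1,2) l(1,2) \<open>k \<noteq> l\<close> f(1,2) g(1,2) k(3) f(3,4)] by blast
  have fT: "\<not> crosses f T"
    using missing_not_both_cross[OF mf k(1,2) l(1,2) \<open>k \<noteq> l\<close> f(1,2) g(1,2) l(3) g(3)] g(4) by blast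
  have ji: "j \<noteq> i"
  proof
    assume "j = i"
    then have "\<not> crosses (e h) ((S - T) \<union> (T - S))" if "h \<in> K" for h
      using that f(3) g(3) forest_edge_card[OF F that] by (simp add: crosses_sym_diff separates_def)
    then have "\<not> crosses f ((S - T) \<union> (T - S))" using missing_uncut[OF mf k(1,2) f(1)] by blast
    then show False using f(4) fT by (simp add: crosses_sym_diff[OF edge_card[OF k(1) f(1)]])
  qed
  have "f \<noteq> g" using gS f(4) by blast
  let ?K = "insert l (insert k (K - {j} - {i}))" and ?e = "e(k := f, l := g)"
  have "swap K1 e1 l ?K ?e i"
    unfolding swap_def
  proof (intro conjI exI)
    show "separates K1 e1 i T" using f(5,6) g(3) fT k l ji by (auto simp: separates_def)
    show "g \<notin> e1 ` K1" using f(5,6) g(2) \<open>f \<noteq> g\<close> k(2) by auto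
  qed (use f g k l ji \<open>k \<noteq> l\<close> in auto)
  moreover have "swap K2 e2 k ?K ?e j"
    unfolding swap_def
  proof (intro conjI exI)
    show "separates K2 e2 j S" using g(5,6) f(3) gS k l ji by (auto simp: separates_def)
    show "f \<notin> e2 ` K2" using g(5,6) f(2) \<open>f \<noteq> g\<close> l(2) by auto
    show "?e = e2(k := f)" using g(6) \<open>k \<noteq> l\<close> by (simp add: fun_upd_twist)
  qed (use f g k l ji \<open>k \<noteq> l\<close> in auto)
  ultimately show ?thesis using ji by blast
qed

section \<open>Sequences of swaps\<close>

inductive reach for K e k where
  refl: "reach K e k K e k"
| step: "reach K e k K' e' k' \<Longrightarrow> swap K' e' k' K'' e'' k'' \<Longrightarrow> reach K e k K'' e'' k''"

lemma reach_max_forest: "reach K e k K' e' k' \<Longrightarrow> max_forest K e \<Longrightarrow> max_forest K' e'"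
  by (induction rule: reach.induct) (auto intro: max_forest_if_swap)

lemma reach_missing:
  "reach K e k K' e' k' \<Longrightarrow> k < length D \<Longrightarrow> k \<notin> K \<Longrightarrow> max_forest K e \<Longrightarrow> k' < length D \<and> k' \<notin> K'"
proof (induction rule: reach.induct)
  case (step K' e' k' K'' e'' k'')
  then have "max_forest K' e'" using reach_max_forest by blast
  then show ?case using step by (auto simp: swap_def max_forest_def rainbow_forest_def)
qed auto

lemma reach_other_missing:
  "reach K e k K' e' k' \<Longrightarrow> l \<notin> K \<Longrightarrow> l \<noteq> k \<Longrightarrow> l \<notin> K' \<and> l \<noteq> k'"
  by (induction rule: reach.induct) (auto simp: swap_def)

text \<open>Diamonds are stacked along the sequence from \<open>k\<close>, carrying the single swap
  at \<open>l\<close> to its end.\<close>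

lemma reach_swap_commute:
  assumes "reach K e k K' e' k'" "max_forest K e" "k \<notin> K" "k \<noteq> l" "swap K e l K2 e2 l2"
  shows "k' \<noteq> l2 \<and> (\<exists>K3 e3. reach K2 e2 k K3 e3 k' \<and> swap K' e' l K3 e3 l2)"
  using assms
proof (induction rule: reach.induct)
  case refl
  then show ?case by (auto simp: swap_def intro: reach.refl)
next
  case (step K' e' k' K'' e'' k'')
  then obtain K3 e3 where 3: "reach K2 e2 k K3 e3 k'" "swap K' e' l K3 e3 l2" by blast
  have "l \<notin> K" using step.prems by (auto simp: swap_def)
  then have "l \<noteq> k'" using reach_other_missing[OF step.hyps(1)] step.prems by auto
  moreover have "max_forest K' e'" using reach_max_forest step by blast
  ultimately obtain K4 e4 where "k'' \<noteq> l2" "swap K'' e'' l K4 e4 l2" "swap K3 e3 k' K4 e4 k''"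
    using swap_diamond[OF _ _ step.hyps(2) 3(2)] by blast
  then show ?case using 3(1) by (auto intro: reach.step)
qed

text \<open>Strips of diamonds fill the grid spanned by both sequences. The induction has to carry
  the common final forest along with the inequality.\<close>

lemma reach_disjoint:
  assumes "reach K e l K2 e2 l2" "max_forest K e" "k \<notin> K" "l \<notin> K" "k \<noteq> l" "reach K e k K' e' k'"
  shows "k' \<noteq> l2"
proof -
  have "k' \<noteq> l2 \<and> (\<exists>K3 e3. reach K2 e2 k K3 e3 k' \<and> reach K' e' l K3 e3 l2)"
    using assms
  proof (induction rule: reach.induct)
    case refl
    then show ?case using reach_other_missing[of K e k K' e' k' l] by (auto intro: reach.refl)
  next
    case (step K2 e2 l2 K4 e4 l4)
    then obtain K3 e3 where 3: "reach K2 e2 k K3 e3 k'" "reach K' e' l K3 e3 l2" by blast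
    have k: "k \<noteq> l2" "k \<notin> K2" using reach_other_missing[OF step.hyps(1)] step.prems by auto
    have "max_forest K2 e2" using reach_max_forest step by blast
    then obtain K5 e5 where "k' \<noteq> l4" "reach K4 e4 k K5 e5 k'" "swap K3 e3 l2 K5 e5 l4"
      using reach_swap_commute[OF 3(1) _ k(2,1) step.hyps(2)] by blast
    then show ?case using 3(2) by (auto intro: reach.step)
  qed
  then show ?thesis by blast
qed

section \<open>Classes of reachable colours\<close>

definition reach_class where
  "reach_class K e k = {k'. \<exists>K' e'. reach K e k K' e' k'}"

lemma swap_in_reach_class:
  assumes "reach K e k K' e' k'" "k' < length D" "k' \<notin> K'" "f \<in> D ! k'" "f \<notin> e' ` K'"
    "separates K' e' j S" "crosses f S" "j \<in> K'"
  shows "j \<in> reach_class K e k"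
proof -
  have "swap K' e' k' (insert k' (K' - {j})) (e'(k' := f)) j" using assms unfolding swap_def by blast
  then show ?thesis using assms(1) reach.step unfolding reach_class_def by blast
qed

text \<open>Although the forest changes, a cut of the initial forest confines the whole class. Two
  facts persist along the sequence: forest edges with colours in the class do not cross
  \<open>X\<close>, and the cycle of the current missing colour lies inside
  \<open>X\<close>.\<close>

lemma reach_class_uncut:
  assumes mf: "max_forest K e" and k: "k < length D" "k \<notin> K"
    and uncut: "\<And>i. i \<in> reach_class K e k - {k} \<Longrightarrow> \<not> crosses (e i) X"
    and meets: "\<Union>(D ! k) \<inter> X \<noteq> {}"
    and reach: "reach K e k K' e' k'"
  shows "\<Union>(D ! k') \<subseteq> X"
proof -
  let ?C = "reach_class K e k"
  \<comment> \<open>The edge \<open>f\<close> crosses every separating cut of a forest edge on its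
    fundamental cycle, so each of those forest edges can be swapped out.\<close>
  have cycle_in_class: "i \<in> ?C \<and> crosses f T"
    if r: "reach K e k K1 e1 k1" and f: "f \<in> D ! k1" "f \<notin> e1 ` K1" and Q: "Q \<subseteq> K1"
      "is_cycle (insert f (e1 ` Q))" and i: "i \<in> Q" and T: "separates K1 e1 i T" for K1 e1 k1 f Q i T
  proof -
    have k1: "k1 < length D" "k1 \<notin> K1" using reach_missing[OF r k mf] by auto
    have "crosses (e1 i) T" using T i Q(1) by (auto simp: separates_def)
    then obtain d where "d \<in> insert f (e1 ` Q)" "d \<noteq> e1 i" "crosses d T"
      using cycle_cut_other_edge[OF Q(2), of "e1 i" T] i by auto
    then have "crosses f T" using T Q(1) by (auto simp: separates_def)
    then show ?thesis using swap_in_reach_class[OF r k1 f T] i Q(1) by auto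
  qed
  have cyc: "\<exists>Q. Q \<subseteq> K1 \<inter> ?C \<and> is_cycle (insert f (e1 ` Q)) \<and>
      (\<forall>i T. i \<in> K1 \<and> separates K1 e1 i T \<and> crosses f T \<longrightarrow> i \<in> Q)"
    if r: "reach K e k K1 e1 k1" and f: "f \<in> D ! k1" "f \<notin> e1 ` K1" for K1 e1 k1 f
  proof -
    have k1: "k1 < length D" "k1 \<notin> K1" using reach_missing[OF r k mf] by auto
    have mf1: "max_forest K1 e1" using reach_max_forest[OF r mf] .
    then have F1: "rainbow_forest K1 e1" by (simp add: max_forest_def)
    obtain Q where Q: "Q \<subseteq> K1" "is_cycle (insert f (e1 ` Q))"
      using fundamental_cycle[OF mf1 k1 f] by blast
    have "Q \<subseteq> ?C"
    proof
      fix i assume "i \<in> Q"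
      moreover obtain T where "separates K1 e1 i T"
        using forest_separator[OF F1] \<open>i \<in> Q\<close> Q(1) by blast
      ultimately show "i \<in> ?C" using cycle_in_class[OF r f Q] by blast
    qed
    moreover have "i \<in> Q" if i: "i \<in> K1" "separates K1 e1 i T" "crosses f T" for i T
    proof -
      obtain d where "d \<in> insert f (e1 ` Q)" "d \<noteq> f" "crosses d T"
        using cycle_cut_other_edge[OF Q(2), of f T] i(3) by auto
      then show ?thesis using i(2) Q(1) by (auto simp: separates_def)
    qed
    ultimately show ?thesis using Q by (intro exI[of _ Q]) auto
  qed
  have D_uncut: "\<not> crosses f X"
    if r: "reach K e k K1 e1 k1" and un: "\<And>i. i \<in> ?C \<inter> K1 \<Longrightarrow> \<not> crosses (e1 i) X"
      and f: "f \<in> D ! k1" for K1 e1 k1 f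
  proof (cases "f \<in> e1 ` K1")
    case True
    then obtain i where i: "i \<in> K1" "f = e1 i" by blast
    have k1: "k1 < length D" "k1 \<notin> K1" using reach_missing[OF r k mf] by auto
    have mf1: "max_forest K1 e1" using reach_max_forest[OF r mf] .
    obtain T where T: "separates K1 e1 i T"
      using mf1 i by (auto simp: max_forest_def rainbow_forest_def)
    have "crosses f T" using T i by (auto simp: separates_def)
    \<comment> \<open>A forest edge lying on \<open>D ! k1\<close> also has its colour in the class:
      a second edge of \<open>D ! k1\<close> across its cut can replace it.\<close>
    then obtain d where d: "d \<in> D ! k1" "d \<noteq> f" "crosses d T"
      using cycle_cut_other_edge[OF cycleD[OF k1(1)] f] by blast
    then have "d \<notin> e1 ` K1" using T i by (auto simp: separates_def)
    then have "i \<in> ?C" using swap_in_reach_class[OF r k1 d(1) _ T d(3) i(1)] by blast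
    then show ?thesis using un i by blast
  next
    case False
    obtain Q where Q: "Q \<subseteq> K1 \<inter> ?C" "is_cycle (insert f (e1 ` Q))"
      using cyc[OF r f False] by blast
    show ?thesis
    proof
      assume "crosses f X"
      then obtain d where "d \<in> insert f (e1 ` Q)" "d \<noteq> f" "crosses d X"
        using cycle_cut_other_edge[OF Q(2), of f X] by auto
      then show False using un Q(1) by auto
    qed
  qed
  have inside: "\<Union>(D ! k1) \<subseteq> X"
    if "reach K e k K1 e1 k1" "\<And>i. i \<in> ?C \<inter> K1 \<Longrightarrow> \<not> crosses (e1 i) X"
      "\<Union>(D ! k1) \<inter> X \<noteq> {}" for K1 e1 k1
    using is_cycle_subset_if_uncut[OF cycleD] D_uncut[OF that(1,2)] reach_missing[OF that(1) k mf] that(3)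
    by blast
  have "(\<forall>i \<in> ?C \<inter> K'. \<not> crosses (e' i) X) \<and> \<Union>(D ! k') \<subseteq> X"
    using reach
  proof (induction rule: reach.induct)
    case refl
    have "\<forall>i \<in> ?C \<inter> K. \<not> crosses (e i) X" using uncut k(2) by auto
    then show ?case using inside[OF reach.refl] meets by blast
  next
    case (step K1 e1 k1 K2 e2 k2)
    have k1: "k1 < length D" "k1 \<notin> K1" using reach_missing[OF step.hyps(1) k mf] by auto
    have r2: "reach K e k K2 e2 k2" using reach.step step.hyps by blast
    obtain f S where f: "f \<in> D ! k1" "f \<notin> e1 ` K1" "separates K1 e1 k2 S" "crosses f S"
      "K2 = insert k1 (K1 - {k2})" "e2 = e1(k1 := f)" "k2 \<in> K1"
      using step.hyps(2) by (auto simp: swap_def)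
    have un1: "\<And>i. i \<in> ?C \<inter> K1 \<Longrightarrow> \<not> crosses (e1 i) X" using step.IH by blast
    have "\<not> crosses f X" using D_uncut[OF step.hyps(1) un1 f(1)] .
    then have un2: "\<And>i. i \<in> ?C \<inter> K2 \<Longrightarrow> \<not> crosses (e2 i) X" using un1 f(5,6) k1(2) by auto
    \<comment> \<open>The freed edge \<open>e1 k2\<close> lies on the fundamental cycle of
      \<open>f\<close>, hence inside \<open>X\<close>. It also belongs to \<open>D ! k2\<close>, so
      the next cycle meets \<open>X\<close>.\<close>
    obtain Q where Q: "Q \<subseteq> K1 \<inter> ?C" "is_cycle (insert f (e1 ` Q))" "k2 \<in> Q"
      using cyc[OF step.hyps(1) f(1,2)] f(3,4,7) by blast
    have fX: "f \<subseteq> X" using step.IH f(1) by blast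
    have "f \<noteq> {}" using edge_card[OF k1(1) f(1)] by auto
    then have "\<Union>(insert f (e1 ` Q)) \<inter> X \<noteq> {}" using fX by blast
    moreover have "\<not> crosses d X" if "d \<in> insert f (e1 ` Q)" for d
      using that un1 Q(1) \<open>\<not> crosses f X\<close> by auto
    ultimately have "\<Union>(insert f (e1 ` Q)) \<subseteq> X" using is_cycle_subset_if_uncut[OF Q(2)] by blast
    then have "e1 k2 \<subseteq> X" using Q(3) by blast
    moreover have F1: "rainbow_forest K1 e1"
      using reach_max_forest[OF step.hyps(1) mf] by (simp add: max_forest_def)
    then have "e1 k2 \<in> D ! k2" "e1 k2 \<noteq> {}"
      using f(7) forest_edge_card[OF F1 f(7)] by (auto simp: rainbow_forest_def)
    ultimately have "\<Union>(D ! k2) \<inter> X \<noteq> {}" by blast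
    then show ?case using inside[OF r2 un2] un2 by blast
  qed
  then show ?thesis by blast
qed

lemma reach_class_subset:
  assumes "max_forest K e" "k < length D" "k \<notin> K"
  shows "reach_class K e k \<subseteq> {..<length D}"
  using reach_missing assms by (auto simp: reach_class_def)

text \<open>The colours of the class other than \<open>k\<close> give at most
  \<open>card (reach_class K e k) - 1\<close> forest edges. \<open>W\<close> is the component of a
  vertex of \<open>D ! k\<close> in the graph of these edges.\<close>

lemma reach_class_dense:
  assumes mf: "max_forest K e" and k: "k < length D" "k \<notin> K"
    and sub: "reach_class K e k - {k} \<subseteq> K"
  shows "\<exists>W. finite W \<and> card W \<le> card (reach_class K e k) \<and> (\<forall>j \<in> reach_class K e k. \<Union>(D ! j) \<subseteq> W)"
proof -
  let ?C = "reach_class K e k"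
  let ?E = "e ` (?C - {k})"
  have F: "rainbow_forest K e" using mf by (simp add: max_forest_def)
  have finC: "finite ?C" using reach_class_subset[OF mf k] by (rule finite_subset) simp
  have kC: "k \<in> ?C" by (auto simp: reach_class_def intro: reach.refl)
  obtain d where d: "d \<in> D ! k" using is_cycle_nonempty[OF cycleD[OF k(1)]] by blast
  then obtain v where v: "v \<in> d" using edge_card[OF k(1)] by fastforce
  let ?W = "{x. (v, x) \<in> (adj ?E)\<^sup>*}"
  have EV: "\<Union>?E \<subseteq> V"
  proof (rule Union_least)
    fix d assume "d \<in> ?E"
    then obtain i where i: "i \<in> K" "d = e i" using sub by blast
    then show "d \<subseteq> V" using in_V[of i] F by (auto simp: rainbow_forest_def)
  qed
  have "\<not> crosses (e i) ?W" if i: "i \<in> ?C - {k}" for i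
  proof (rule uncut_component)
    show "card (e i) = 2" using forest_edge_card[OF F, of i] i sub by blast
  qed (use i in simp)
  moreover have "\<Union>(D ! k) \<inter> ?W \<noteq> {}" using d v by auto
  ultimately have "\<forall>j \<in> ?C. \<Union>(D ! j) \<subseteq> ?W"
    using reach_class_uncut[OF mf k] unfolding reach_class_def by blast
  moreover have "card ?W \<le> card ?C"
  proof -
    have "card ?W \<le> card ?E + 1" using card_component_le[OF _ fin EV] finC by simp
    also have "card ?E \<le> card (?C - {k})" using finC by (intro card_image_le) simp
    finally show ?thesis using finC kC card_Diff_singleton[of k ?C] card_gt_0_iff[of ?C] by fastforce
  qed
  moreover have "finite ?W" using finite_component[OF fin EV] .
  ultimately show ?thesis by blast
qed

lemma reach_classes_disjoint:
  assumes "max_forest K e" "k \<notin> K" "l \<notin> K" "k \<noteq> l"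
  shows "reach_class K e k \<inter> reach_class K e l = {}"
  using reach_disjoint[OF _ assms(1-4)] unfolding reach_class_def by blast

section \<open>Counting the colours\<close>

lemma length_bound:
  assumes "V \<noteq> {}"
  shows "5 * length D \<le> 6 * (card V - 1)"
proof -
  obtain K e where mf: "max_forest K e" using max_forest_exists by blast
  then have F: "rainbow_forest K e" by (simp add: max_forest_def)
  have K: "K \<subseteq> {..<length D}" "finite K"
    using F forest_finite by (auto simp: rainbow_forest_def)
  let ?M = "{..<length D} - K" and ?C = "reach_class K e"
  have self: "k \<in> ?C k" for k by (auto simp: reach_class_def intro: reach.refl)
  have sub: "?C k - {k} \<subseteq> K" if k: "k \<in> ?M" for k
  proof
    fix j assume j: "j \<in> ?C k - {k}"
    show "j \<in> K"
    proof (rule ccontr)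
      assume "j \<notin> K"
      \<comment> \<open>A second missing colour \<open>j\<close> would lie in its own class as
        well.\<close>
      then have "?C k \<inter> ?C j = {}" using reach_classes_disjoint[OF mf] k j by blast
      then show False using self[of j] j by blast
    qed
  qed
  have finC: "finite (?C k)" if "k \<in> ?M" for k
    using reach_class_subset[OF mf, of k] that by (auto intro: finite_subset)
  have C6: "5 \<le> card (?C k - {k})" if k: "k \<in> ?M" for k
  proof (rule ccontr)
    assume "\<not> 5 \<le> card (?C k - {k})"
    then have small: "card (?C k) \<le> 5" using finC[OF k] self[of k] by simp
    obtain W where W: "finite W" "card W \<le> card (?C k)" "\<forall>j \<in> ?C k. \<Union>(D ! j) \<subseteq> W"
      using reach_class_dense[OF mf _ _ sub[OF k]] k by auto
    have "has_rainbow_even_cycle D"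
    proof (rule rainbow_if_dense[OF W(1)])
      show "?C k \<subseteq> {..<length D}" using reach_class_subset[OF mf] k by auto
      then show "even_cycle (D ! j) \<and> \<Union>(D ! j) \<subseteq> W" if "j \<in> ?C k" for j
        using that even_cycles W(3) by auto
    qed (use W(2) small self[of k] in auto)
    then show False using no_rainbow by simp
  qed
  have "5 * card ?M \<le> (\<Sum>k \<in> ?M. card (?C k - {k}))"
    using sum_bounded_below[of ?M 5 "\<lambda>k. card (?C k - {k})"] C6 by (simp add: mult.commute)
  also have "\<dots> = card (\<Union>k \<in> ?M. ?C k - {k})"
  proof (rule card_UN_disjoint[symmetric])
    show "\<forall>k \<in> ?M. \<forall>l \<in> ?M. k \<noteq> l \<longrightarrow> (?C k - {k}) \<inter> (?C l - {l}) = {}"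
      using reach_classes_disjoint[OF mf] by blast
  qed (use finC in auto)
  also have "\<dots> \<le> card K" using sub K(2) by (intro card_mono) auto
  finally have M: "5 * card ?M \<le> card K" .
  have "card ?M + card K = length D"
    using K card_mono[OF _ K(1)] by (simp add: card_Diff_subset)
  then have "5 * length D \<le> 6 * card K" using M by linarith
  also have "\<dots> \<le> 6 * (card V - 1)" using forest_card_le[OF F assms] by simp
  finally show ?thesis .
qed

end

theorem theorem1p2:
  fixes V :: "'a set" and n :: nat and D :: "'a set set list"
  assumes "finite V" and "card V = n" and "n \<ge> 1"
    and "length D = 6 * (n - 1) div 5 + 1"
    and "\<forall>i < length D. even_cycle (D ! i) \<and> \<Union>(D ! i) \<subseteq> V"
  shows "has_rainbow_even_cycle D"
proof (rule ccontr)
  assume "\<not> has_rainbow_even_cycle D"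
  then interpret rainbow_even_free V D
    using assms(1,5) by unfold_locales auto
  have "V \<noteq> {}" using assms(2,3) by auto
  then have "5 * length D \<le> 6 * (n - 1)" using length_bound assms(2) by simp
  \<comment> \<open>The number \<open>6 * (n - 1) div 5 + 1\<close> is the least whose fivefold
    exceeds \<open>6 * (n - 1)\<close>.\<close>
  then show False using assms(4) by linarith
qed

end
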